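(* Let $\Lambda\subset\mathbb R^d$ be a Bravais lattice and let $G=(V,E,K,s,t)$ be a finite connected two-terminal weighted multigraph with kernels $K_e\in\ell^1(\Lambda)$ for all $e\in E$. Let $\mathcal B(G)$ be its set of blocks, $\mathcal S(G)$ its spine and $\mathcal A(G)=\mathcal B(G)\setminus\mathcal S(G)$ its attachments. Then, for all $\boldsymbol k\in\mathrm{BZ}$, $$\mathcal Z_G(\boldsymbol k)=\prod_{B\in\mathcal S(G)}\mathcal Z_B(\boldsymbol k)\,\prod_{B\in\mathcal A(G)}\mathcal Z_B(\boldsymbol 0).$$ Here only the spine factors depend on $\boldsymbol k$. In particular, when $s=t$, every factor can be evaluated at $\boldsymbol k=\boldsymbol 0$ and $$\mathcal Z_G(\boldsymbol k)=\prod_{B\in\mathcal B(G)}\mathcal Z_B(\boldsymbol 0)=\mathcal Z_G(\boldsymbol 0).$$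
   Context: Lattice: $\Lambda=A\mathbb Z^d$ with $A\in\mathbb R^{d\times d}$ invertible, $\mathrm{BZ}=A^{-T}[0,1)^d$. Multigraph: $(V,E)$ with node set $V\subset\mathbb N$, edge set $E$, and an incidence map assigning to each $e\in E$ an ordered pair $(e^-,e^+)\in V\times V$ with $e^-\ne e^+$ (tail and head); parallel edges are allowed. Connectivity disregards orientation. A two-terminal weighted multigraph $G=(V,E,K,s,t)$ additionally carries a kernel $K_e:\Lambda\to\mathbb C$ for each edge and terminals $s,t\in V$ (source and sink, $s=t$ allowed). Graph lattice sum: for $G$ finite and connected with $K_e\in\ell^1(\Lambda)$, $$\mathcal Z_G(\boldsymbol k)=\mathcal Z_{\Lambda,G}(\boldsymbol k)=\sum_{\{\boldsymbol x_v\in\Lambda\}_{v\neq p}}e^{-2\pi i(\boldsymbol x_t-\boldsymbol x_s)\cdot\boldsymbol k}\prod_{e\in E}K_e(\boldsymbol x_{e^+}-\boldsymbol x_{e^-}),\qquad \boldsymbol k\in\mathrm{BZ},$$ where the sum runs over positions of all nodes $v\in V\setminus\{p\}$, with an arbitrary pinning node $p\in V$ whose position $\boldsymbol x_p\in\Lambda$ is held fixed (the sum converges absolutely, and its value depends neither on $p$ nor on $\boldsymbol x_p$). Blocks: a cutvertex of a connected graph is a vertex whose removal disconnects it. A block is a maximal connected subgraph without a cutvertex (a maximal 2-connected subgraph, or a single bridge). The blocks partition $E$. The block-cut tree $T(G)$ has the blocks and cutvertices of $G$ as nodes, a block $B$ being joined to a cutvertex $c$ whenever $c\in B$. Spine and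 attachments: the blocks on the unique path in $T(G)$ between a block containing $s$ and a block containing $t$, taken in order $B_1,\dots,B_m$, form the spine $\mathcal S(G)=\{B_1,\dots,B_m\}$. Consecutive spine blocks meet at the cutvertices $p_i$, $\{p_i\}=V(B_i)\cap V(B_{i+1})$; set $p_0=s$, $p_m=t$. The spine block $B_i$ is assigned the terminals $(p_{i-1},p_i)$, and $\mathcal Z_{B_i}(\boldsymbol k)$ is its graph lattice sum (with the restricted kernels) for these terminals. The remaining blocks form $\mathcal A(G)$; for an attachment $B$, $\mathcal Z_B(\boldsymbol 0)$ is the graph lattice sum of $B$ at $\boldsymbol k=\boldsymbol 0$, which is independent of the choice of terminals. *)

theory Defs
  imports
    "HOL-Analysis.Analysis"
    "Graph_Theory.Digraph_Component"
    "Graph_Theory.Vertex_Walk"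
begin

section \<open>Lattices and graph lattice sums\<close>

definition lattice :: "real^'n^'n \<Rightarrow> (real^'n) set" where
  "lattice A = {A *v z |z. \<forall>i. z $ i \<in> \<int>}"

definition brillouin_zone :: "real^'n^'n \<Rightarrow> (real^'n) set" where
  "brillouin_zone A = {transpose (matrix_inv A) *v y |y. \<forall>i. 0 \<le> y $ i \<and> y $ i < 1}"

text \<open>
  The node \<open>p\<close> is pinned at \<open>x\<^sub>0\<close> and the sum runs over the positions of all other nodes; \<open>s\<close> and
  \<open>t\<close> are source and sink. Parallel edges are distinct elements of \<open>arcs G\<close>. For a subgraph the
  restricted kernels are again given by \<open>K\<close>, since only the kernels of \<open>arcs G\<close> enter, and only
  their values on \<open>L\<close>.
\<close>
definition graph_lattice_sum ::
  "(real^'n) set \<Rightarrow> ('e \<Rightarrow> real^'n \<Rightarrow> complex) \<Rightarrow> (nat, 'e) pre_digraph \<Rightarrow> nat \<Rightarrow> nat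
    \<Rightarrow> nat \<Rightarrow> real^'n \<Rightarrow> real^'n \<Rightarrow> complex" where
  "graph_lattice_sum L K G s t p x\<^sub>0 k =
    (\<Sum>\<^sub>\<infinity> y \<in> (\<Pi>\<^sub>E v \<in> verts G - {p}. L).
      let x = y(p := x\<^sub>0) in
        exp (- 2 * complex_of_real pi * \<i> * complex_of_real ((x t - x s) \<bullet> k))
        * (\<Prod>e\<in>arcs G. K e (x (head G e) - x (tail G e))))"


section \<open>Blocks, block-cut tree and spine\<close>

text \<open>
  Deleting the only node of a one-node graph does not disconnect it, although the library does not
  count the empty graph as connected.
\<close>
definition cutvertex :: "('v, 'e) pre_digraph \<Rightarrow> 'v \<Rightarrow> bool" where
  "cutvertex G v \<longleftrightarrow> v \<in> verts G \<and> verts G \<noteq> {v} \<and>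
     \<not> Digraph_Component.connected (pre_digraph.del_vert G v)"

text \<open>
  ``Without a cutvertex'' refers to cutvertices of the subgraph itself. If \<open>G\<close> has a single node and
  no edge, its only block is \<open>G\<close>.
\<close>
definition blocks :: "('v, 'e) pre_digraph \<Rightarrow> ('v, 'e) pre_digraph set" where
  "blocks G = {B. pre_digraph.max_subgraph G
     (\<lambda>H. Digraph_Component.connected H \<and> (\<forall>v. \<not> cutvertex H v)) B}"

text \<open>The undirected tree is represented, as usual in this library, by a symmetric digraph.\<close>
definition block_cut_tree ::
  "('v, 'e) pre_digraph \<Rightarrow>
    (('v, 'e) pre_digraph + 'v, (('v, 'e) pre_digraph + 'v) \<times> (('v, 'e) pre_digraph + 'v)) pre_digraph"
where
  "block_cut_tree G =
    \<lparr> verts = Inl ` blocks G \<union> Inr ` {c. cutvertex G c},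
      arcs = {(Inl B, Inr c) |B c. B \<in> blocks G \<and> cutvertex G c \<and> c \<in> verts B}
           \<union> {(Inr c, Inl B) |B c. B \<in> blocks G \<and> cutvertex G c \<and> c \<in> verts B},
      tail = fst, head = snd \<rparr>"

text \<open>
  If a terminal is a cutvertex it lies in several blocks, and every choice of the end blocks of the
  path is allowed; hence the spine is a relation.
\<close>
definition is_spine ::
  "('v, 'e) pre_digraph \<Rightarrow> 'v \<Rightarrow> 'v \<Rightarrow> ('v, 'e) pre_digraph list \<Rightarrow> bool" where
  "is_spine G s t Bs \<longleftrightarrow>
    (\<exists>q B B'. vpath q (block_cut_tree G) \<and> hd q = Inl B \<and> s \<in> verts B
       \<and> last q = Inl B' \<and> t \<in> verts B' \<and> Bs = map projl (filter isl q))"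

text \<open>
  The node \<open>p\<^sub>i\<close>, for \<open>i = 0, \<dots>, m\<close> and spine \<open>B\<^sub>1, \<dots>, B\<^sub>m\<close>. Lists are indexed from \<open>0\<close>, so
  \<open>B\<^sub>i = Bs ! (i - 1)\<close>.
\<close>
definition spine_node :: "'v \<Rightarrow> 'v \<Rightarrow> ('v, 'e) pre_digraph list \<Rightarrow> nat \<Rightarrow> 'v" where
  "spine_node s t Bs i =
    (if i = 0 then s else if i = length Bs then t
     else the_elem (verts (Bs ! (i - 1)) \<inter> verts (Bs ! i)))"

end

theory Submission
  imports Defs
begin

text \<open>
  The theorem says that summing over node positions factorizes along cutvertices. If a cutvertex \<open>c\<close>
  separates \<open>G\<close> into two sides that share no arc and only the node \<open>c\<close>, then after pinning \<open>c\<close> the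
  positions on the two sides vary independently and the product of kernels splits, so by Fubini the
  sum is the product of the sums of the sides (\<open>infsum_configs_glue\<close>). Pinning \<open>c\<close> instead of the given
  node costs nothing, since the summand is invariant under translations by the lattice
  (\<open>infsum_configs_repin\<close>). Fubini requires absolute convergence, which follows from the summability of
  the kernels along a spanning tree and their boundedness on the other arcs
  (\<open>kernel_product_abs_summable\<close>).

  Combinatorially, the blocks of \<open>G\<close> are the blocks of the two sides, without repetition
  (\<open>blocks_split\<close>, \<open>blocks_disjoint\<close>): a connected subgraph without cutvertex cannot reach from one side
  to the other through \<open>c\<close>. Hence an induction over cutvertices (\<open>connected_separation_induct\<close>) reduces
  everything to graphs that are their own only block.

  The Fourier factor is the remaining point. The induction is carried out for a product of phases,
  one for each block, with arbitrary terminals and momenta (\<open>infsum_block_weight\<close>). Along the spine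
  \<open>x\<^sub>t - x\<^sub>s\<close> is the telescoping sum of the differences between consecutive spine nodes, so the phase of
  \<open>G\<close> is the product of the phases of the spine blocks at momentum \<open>k\<close>, and the attachments receive
  momentum \<open>0\<close>.
\<close>

section \<open>Connectedness through crossing arcs\<close>

text \<open>
  Reachability in the symmetrized graph is awkward to transport between a graph, its subgraphs and
  its vertex deletions. An undirected graph is connected iff no proper nonempty set of vertices is
  closed under adjacency, and this cut form only mentions \<^const>\<open>verts\<close> and \<^const>\<open>arcs\<close>; every
  connectedness argument below goes through it.
\<close>
lemma connected_iff_crossing_arc:
  assumes "wf_digraph G"
  shows "Digraph_Component.connected G \<longleftrightarrow> verts G \<noteq> {} \<and>
    (\<forall>S \<subseteq> verts G. S \<noteq> {} \<and> S \<noteq> verts G \<longrightarrow> (\<exists>e \<in> arcs G. (tail G e \<in> S) \<noteq> (head G e \<in> S)))"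
    (is "?L \<longleftrightarrow> ?R")
proof -
  interpret wf_digraph G by fact
  interpret M: pair_wf_digraph "mk_symmetric G" ..
  have dom: "(x, y) \<in> parcs (mk_symmetric G) \<longleftrightarrow>
      (\<exists>e \<in> arcs G. (x = tail G e \<and> y = head G e) \<or> (x = head G e \<and> y = tail G e))" for x y
    by (auto simp: parcs_mk_symmetric)
  show ?thesis
  proof
    assume conn: ?L
    show ?R
    proof (intro conjI allI impI)
      show "verts G \<noteq> {}"
        using conn by (auto simp: Digraph_Component.connected_def strongly_connected_def)
    next
      fix S assume S: "S \<subseteq> verts G" "S \<noteq> {} \<and> S \<noteq> verts G"
      then obtain u v where uv: "u \<in> S" "v \<in> verts G" "v \<notin> S" by auto
      with S conn have reach: "u \<rightarrow>\<^sup>*\<^bsub>with_proj (mk_symmetric G)\<^esub> v"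
        by (auto simp: Digraph_Component.connected_def strongly_connected_def)
      show "\<exists>e \<in> arcs G. (tail G e \<in> S) \<noteq> (head G e \<in> S)"
      proof (rule ccontr)
        assume closed: "\<not> ?thesis"
        from reach have "v \<in> S"
        proof (induction rule: M.reachable_induct)
          case base
          show ?case by fact
        next
          case (step x y)
          then show ?case using closed unfolding dom by blast
        qed
        with uv show False by simp
      qed
    qed
  next
    assume cross: ?R
    have "u \<rightarrow>\<^sup>*\<^bsub>with_proj (mk_symmetric G)\<^esub> v" if uv: "u \<in> verts G" "v \<in> verts G" for u v
    proof (rule ccontr)
      assume nr: "\<not> ?thesis"
      define S where "S = {w. u \<rightarrow>\<^sup>*\<^bsub>with_proj (mk_symmetric G)\<^esub> w}"
      have "S \<subseteq> verts G" unfolding S_def using M.reachable_in_verts by fastforce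
      moreover have "u \<in> S" unfolding S_def using uv by (auto intro!: M.reachable_refl)
      moreover have "v \<notin> S" using nr by (simp add: S_def)
      ultimately obtain e where e: "e \<in> arcs G" "(tail G e \<in> S) \<noteq> (head G e \<in> S)"
        using cross uv by (metis empty_iff)
      have "(tail G e, head G e) \<in> parcs (mk_symmetric G)"
        "(head G e, tail G e) \<in> parcs (mk_symmetric G)"
        using e unfolding dom by blast+
      with e(2) show False unfolding S_def using M.reachable_adj_trans by blast
    qed
    with cross show ?L
      by (auto simp: Digraph_Component.connected_def strongly_connected_def)
  qed
qed

lemma connected_crossing_arcE:
  assumes "wf_digraph G" "Digraph_Component.connected G"
    and "S \<subseteq> verts G" "S \<noteq> {}" "S \<noteq> verts G"
  obtains e where "e \<in> arcs G" "(tail G e \<in> S) \<noteq> (head G e \<in> S)"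
  using assms connected_iff_crossing_arc by blast


section \<open>Blocks and separations at a cutvertex\<close>

definition nonseparable :: "('v, 'e) pre_digraph \<Rightarrow> bool" where
  "nonseparable H \<longleftrightarrow> Digraph_Component.connected H \<and> (\<forall>v. \<not> cutvertex H v)"

lemma in_blocks_iff:
  "B \<in> blocks G \<longleftrightarrow> subgraph B G \<and> nonseparable B \<and>
    (\<forall>H. subgraph B H \<and> subgraph H G \<and> nonseparable H \<longrightarrow> H = B)"
  by (auto simp: blocks_def pre_digraph.max_subgraph_def nonseparable_def)

lemma block_subgraph: "B \<in> blocks G \<Longrightarrow> subgraph B G"
  by (simp add: in_blocks_iff)

lemma subgraph_antisym:
  assumes "subgraph H G" "subgraph G H"
  shows "H = G"
  using assms by (auto simp: subgraph_def compatible_def intro!: pre_digraph.equality)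

lemma blocks_nonseparable:
  assumes "wf_digraph G" "nonseparable G"
  shows "blocks G = {G}"
proof -
  have "subgraph G G" using assms(1) by (rule wf_digraph.subgraph_refl)
  then show ?thesis using assms(2) by (auto simp: in_blocks_iff intro: subgraph_antisym)
qed

lemma nonseparable_single_arc:
  assumes "wf_digraph H" "verts H = {tail H e, head H e}" "arcs H = {e}"
  shows "nonseparable H"
proof -
  have "Digraph_Component.connected H"
    using assms(2,3) by (subst connected_iff_crossing_arc[OF assms(1)]) auto
  moreover have "\<not> cutvertex H v" for v
  proof
    assume cut: "cutvertex H v"
    have "wf_digraph (pre_digraph.del_vert H v)"
      using assms(1) by (rule wf_digraph.wf_digraph_del_vert)
    moreover from cut have "v \<in> verts H" "verts H \<noteq> {v}" by (auto simp: cutvertex_def)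
    with assms(2) obtain u where "verts (pre_digraph.del_vert H v) = {u}"
      by (cases "v = tail H e") (auto simp: pre_digraph.verts_del_vert insert_Diff_if)
    ultimately have "Digraph_Component.connected (pre_digraph.del_vert H v)"
      by (simp add: connected_iff_crossing_arc subset_singleton_iff)
    with cut show False by (simp add: cutvertex_def)
  qed
  ultimately show ?thesis by (simp add: nonseparable_def)
qed

text \<open>
  A vertex \<open>c\<close> of a connected loop-free graph with further vertices lies on an arc to another vertex,
  and that arc alone is a nonseparable subgraph properly containing the one on \<open>{c}\<close>. This is what
  keeps trivial blocks from appearing when a graph is cut into two sides that share only \<open>c\<close>.
\<close>
lemma block_not_singleton:
  assumes "loopfree_digraph G" "Digraph_Component.connected G"
    and "c \<in> verts G" "verts G \<noteq> {c}" "B \<in> blocks G"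
  shows "\<not> verts B \<subseteq> {c}"
proof
  assume sub: "verts B \<subseteq> {c}"
  interpret loopfree_digraph G by fact
  obtain e where e: "e \<in> arcs G" "(tail G e \<in> {c}) \<noteq> (head G e \<in> {c})"
    using connected_crossing_arcE[OF wf_digraph assms(2), of "{c}"] assms(3,4) by auto
  define H where "H = \<lparr>verts = {tail G e, head G e}, arcs = {e}, tail = tail G, head = head G\<rparr>"
  have wfH: "wf_digraph H" by unfold_locales (auto simp: H_def)
  have "nonseparable H" using wfH by (rule nonseparable_single_arc) (auto simp: H_def)
  moreover have HG: "subgraph H G"
    using e(1) wfH wf_digraph by (auto simp: H_def subgraph_def compatible_def)
  moreover have BG: "subgraph B G" using assms(5) by (rule block_subgraph)
  have wfB: "wf_digraph B" and compB: "tail B = tail G" "head B = head G"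
    using BG by (auto simp: subgraph_def compatible_def)
  have "arcs B = {}"
  proof (rule ccontr)
    assume "arcs B \<noteq> {}"
    then obtain b where b: "b \<in> arcs B" by auto
    then have "tail G b = c" "head G b = c"
      using sub wf_digraph.wellformed[OF wfB b] compB by auto
    moreover have "b \<in> arcs G" using b BG by auto
    ultimately show False using no_loops by metis
  qed
  then have "subgraph B H"
    using sub e(2) wfH wfB compB by (auto simp: H_def subgraph_def compatible_def)
  ultimately have "H = B" using assms(5) by (auto simp: in_blocks_iff)
  with \<open>arcs B = {}\<close> show False by (auto simp: H_def)
qed

text \<open>
  The outcome of splitting \<open>G\<close> at a cutvertex \<open>c\<close>: \<open>X\<close> and \<open>Y\<close> are unions of connected components of
  \<open>G - c\<close>. The situation is symmetric in \<open>X\<close> and \<open>Y\<close>, so facts are proved for the side \<open>insert c X\<close>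
  only and obtained for the other side from the interchanged interpretation.
\<close>
locale cut_separation = fin_digraph G + loopfree_digraph G
  for G :: "('v, 'e) pre_digraph" +
  fixes c :: 'v and X Y :: "'v set"
  assumes conn: "Digraph_Component.connected G"
    and verts_split: "verts G = insert c (X \<union> Y)"
    and parts: "c \<notin> X" "c \<notin> Y" "X \<inter> Y = {}" "X \<noteq> {}" "Y \<noteq> {}"
    and no_arc_across: "e \<in> arcs G \<Longrightarrow>
      \<not> (tail G e \<in> X \<and> head G e \<in> Y) \<and> \<not> (tail G e \<in> Y \<and> head G e \<in> X)"
begin

lemma swap: "cut_separation G c Y X"
  using conn verts_split parts no_arc_across by unfold_locales auto

abbreviation "side1 \<equiv> G \<restriction> insert c X"
abbreviation "side2 \<equiv> G \<restriction> insert c Y"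

lemma side_subgraph: "subgraph side1 G"
  using verts_split by (intro subgraph_induce_subgraphI) auto

lemma side_fin: "fin_digraph side1"
  using side_subgraph by (rule fin_digraph_subgraph)

lemma side_loopfree: "loopfree_digraph side1"
proof -
  have "wf_digraph side1" using side_subgraph by auto
  then show ?thesis
    unfolding loopfree_digraph_def loopfree_digraph_axioms_def by (auto dest: no_loops)
qed

text \<open>
  A set that avoids \<open>c\<close> and lies in \<open>X\<close> is crossed by an arc of \<open>G\<close>; no arc joins \<open>X\<close> to \<open>Y\<close>, so this
  arc stays inside the side.
\<close>
lemma side_connected: "Digraph_Component.connected side1"
proof -
  have wf: "wf_digraph side1" using side_subgraph by auto
  have cross: "\<exists>e \<in> arcs side1. (tail G e \<in> S) \<noteq> (head G e \<in> S)" if "S \<subseteq> X" "S \<noteq> {}" for S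
  proof -
    have "S \<subseteq> verts G" "S \<noteq> verts G" using that parts verts_split by auto
    then obtain e where e: "e \<in> arcs G" "(tail G e \<in> S) \<noteq> (head G e \<in> S)"
      by (rule connected_crossing_arcE[OF wf_digraph conn _ \<open>S \<noteq> {}\<close>])
    have "tail G e \<in> insert c (X \<union> Y)" "head G e \<in> insert c (X \<union> Y)"
      using e(1) verts_split wellformed by auto
    with e that no_arc_across[OF e(1)] parts have "e \<in> arcs side1" by auto
    with e show ?thesis by blast
  qed
  show ?thesis
  proof (subst connected_iff_crossing_arc[OF wf], intro conjI allI impI)
    fix S assume S: "S \<subseteq> verts side1" "S \<noteq> {} \<and> S \<noteq> verts side1"
    show "\<exists>e \<in> arcs side1. (tail side1 e \<in> S) \<noteq> (head side1 e \<in> S)"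
    proof (cases "c \<in> S")
      case False
      with S cross[of S] show ?thesis by auto
    next
      \<comment> \<open>crossing a set and crossing its complement are the same\<close>
      case True
      with S have "insert c X - S \<subseteq> X" "insert c X - S \<noteq> {}" by auto
      from cross[OF this] show ?thesis by auto
    qed
  qed auto
qed

text \<open>
  A nonseparable subgraph meeting both \<open>X\<close> and \<open>Y\<close> would stay connected after deleting \<open>c\<close>, hence would
  contain an arc between \<open>X\<close> and \<open>Y\<close>.
\<close>
lemma nonseparable_in_one_side:
  assumes "subgraph H G" "nonseparable H"
  shows "subgraph H side1 \<or> subgraph H side2"
proof -
  have wfH: "wf_digraph H" and comp: "tail H = tail G" "head H = head G"
    and VH: "verts H \<subseteq> verts G" and AH: "arcs H \<subseteq> arcs G"
    using assms(1) by (auto simp: subgraph_def compatible_def)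
  have "verts H \<subseteq> insert c X \<or> verts H \<subseteq> insert c Y"
  proof (rule ccontr)
    assume "\<not> ?thesis"
    with VH verts_split obtain x y where xy: "x \<in> verts H" "x \<in> X" "y \<in> verts H" "y \<in> Y"
      by blast
    let ?D = "pre_digraph.del_vert H c"
    have wfD: "wf_digraph ?D" using wfH by (rule wf_digraph.wf_digraph_del_vert)
    have "Digraph_Component.connected ?D"
    proof (cases "c \<in> verts H")
      case True
      with xy parts assms(2) show ?thesis by (auto simp: nonseparable_def cutvertex_def)
    next
      case False
      then have "?D = H"
        using wf_digraph.wellformed[OF wfH]
        by (intro pre_digraph.equality) (auto simp: pre_digraph.del_vert_simps)
      with assms(2) show ?thesis by (simp add: nonseparable_def)
    qed
    then obtain e where e: "e \<in> arcs ?D" "(tail ?D e \<in> X \<inter> verts H) \<noteq> (head ?D e \<in> X \<inter> verts H)"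
      by (rule connected_crossing_arcE[OF wfD, of "X \<inter> verts H"])
        (use xy parts in \<open>auto simp: pre_digraph.del_vert_simps\<close>)
    then have "e \<in> arcs H" "tail G e \<noteq> c" "head G e \<noteq> c"
      "(tail G e \<in> X \<inter> verts H) \<noteq> (head G e \<in> X \<inter> verts H)"
      by (auto simp: pre_digraph.del_vert_simps comp)
    with no_arc_across[of e] wf_digraph.wellformed[OF wfH, of e] VH AH verts_split comp
    show False by auto
  qed
  moreover have "subgraph H (G \<restriction> S)" if "verts H \<subseteq> S" "S \<subseteq> verts G" for S
  proof -
    have "wf_digraph (G \<restriction> S)" using subgraph_induce_subgraphI[OF that(2)] by auto
    with that wfH AH comp wf_digraph.wellformed[OF wfH] show ?thesis
      by (auto simp: subgraph_def compatible_def)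
  qed
  ultimately show ?thesis using verts_split by auto
qed

lemma block_of_side_not_in_other_side:
  assumes "B \<in> blocks side1"
  shows "\<not> verts B \<subseteq> insert c Y"
proof
  assume "verts B \<subseteq> insert c Y"
  moreover have "verts B \<subseteq> insert c X"
    using block_subgraph[OF assms] by (auto simp: subgraph_def)
  ultimately have "verts B \<subseteq> {c}" using parts by auto
  then show False
    using block_not_singleton[OF side_loopfree side_connected _ _ assms, of c] parts by auto
qed

text \<open>
  Maximality in the side passes to \<open>G\<close>: a larger nonseparable subgraph of \<open>G\<close> again lies in one side,
  and it cannot be the other one, because the block has a vertex in \<open>X\<close>.
\<close>
lemma block_of_side: "blocks side1 \<subseteq> blocks G"
proof
  fix B assume B: "B \<in> blocks side1"
  have "H = B" if H: "subgraph B H" "subgraph H G" "nonseparable H" for H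
  proof -
    have "verts B \<subseteq> verts H" using H(1) by (simp add: subgraph_def)
    then have "\<not> verts H \<subseteq> insert c Y" using block_of_side_not_in_other_side[OF B] by blast
    then have "\<not> subgraph H side2" by (simp add: subgraph_def)
    with nonseparable_in_one_side[OF H(2,3)] have "subgraph H side1" by blast
    with H B show ?thesis unfolding in_blocks_iff by blast
  qed
  then show "B \<in> blocks G"
    using B subgraph_trans[OF _ side_subgraph] unfolding in_blocks_iff by blast
qed

lemma blocks_split: "blocks G = blocks side1 \<union> blocks side2"
proof -
  interpret S: cut_separation G c Y X by (rule swap)
  have "B \<in> blocks side1 \<union> blocks side2" if "B \<in> blocks G" for B
  proof -
    from that have B: "subgraph B G" "nonseparable B"
      and max: "\<And>H. subgraph B H \<Longrightarrow> subgraph H G \<Longrightarrow> nonseparable H \<Longrightarrow> H = B"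
      unfolding in_blocks_iff by blast+
    have "subgraph H side1 \<or> subgraph H side2 \<Longrightarrow> subgraph H G" for H
      using subgraph_trans[OF _ side_subgraph] subgraph_trans[OF _ S.side_subgraph] by blast
    with nonseparable_in_one_side[OF B] show ?thesis
      unfolding Un_iff in_blocks_iff using B(2) max by meson
  qed
  then show ?thesis using block_of_side S.block_of_side by blast
qed

lemma blocks_disjoint: "blocks side1 \<inter> blocks side2 = {}"
proof -
  have "verts B \<subseteq> insert c Y" if "B \<in> blocks side2" for B
    using block_subgraph[OF that] by (simp add: subgraph_def)
  then show ?thesis using block_of_side_not_in_other_side by blast
qed

lemma arcs_split: "arcs G = arcs side1 \<union> arcs side2"
  using no_arc_across wellformed verts_split by auto

lemma arcs_disjoint: "arcs side1 \<inter> arcs side2 = {}"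
proof -
  have "insert c X \<inter> insert c Y = {c}" using parts(1-3) by blast
  have "tail G e = head G e" if "e \<in> arcs side1" "e \<in> arcs side2" for e
  proof -
    have "tail G e \<in> insert c X \<inter> insert c Y" "head G e \<in> insert c X \<inter> insert c Y"
      using that unfolding induce_subgraph_arcs by blast+
    then show ?thesis unfolding \<open>insert c X \<inter> insert c Y = {c}\<close> by simp
  qed
  moreover have "e \<in> arcs G" if "e \<in> arcs side1" for e
    using that unfolding induce_subgraph_arcs by blast
  ultimately show ?thesis using no_loops by blast
qed

lemma side_smaller: "card (verts side1) < card (verts G)"
  using verts_split parts by (intro psubset_card_mono finite_verts) auto

end

lemma cutvertex_separation:
  assumes "fin_digraph G" "loopfree_digraph G" "Digraph_Component.connected G" "cutvertex G c"
  obtains X Y where "cut_separation G c X Y"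
proof -
  interpret fin_digraph G by fact
  interpret loopfree_digraph G by fact
  let ?D = "pre_digraph.del_vert G c"
  have c: "c \<in> verts G" "verts G \<noteq> {c}" "\<not> Digraph_Component.connected ?D"
    using assms(4) by (auto simp: cutvertex_def)
  then obtain X where X: "X \<subseteq> verts G - {c}" "X \<noteq> {}" "X \<noteq> verts G - {c}"
    and none: "\<forall>e \<in> arcs G. tail G e \<noteq> c \<longrightarrow> head G e \<noteq> c \<longrightarrow> (tail G e \<in> X) = (head G e \<in> X)"
    unfolding connected_iff_crossing_arc[OF wf_digraph_del_vert]
    by (auto simp: pre_digraph.del_vert_simps)
  have "cut_separation G c X (verts G - {c} - X)"
  proof
    show "verts G = insert c (X \<union> (verts G - {c} - X))" using c X by auto
    show "c \<notin> X" "c \<notin> verts G - {c} - X" "X \<inter> (verts G - {c} - X) = {}" "X \<noteq> {}"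
      "verts G - {c} - X \<noteq> {}"
      using X by auto
    show "\<not> (tail G e \<in> X \<and> head G e \<in> verts G - {c} - X) \<and>
      \<not> (tail G e \<in> verts G - {c} - X \<and> head G e \<in> X)" if "e \<in> arcs G" for e
      using none that X by blast
  qed (rule assms(3))
  then show thesis by (rule that)
qed

text \<open>
  Decomposition into blocks, recast as an induction principle: a property of connected graphs holds
  if it holds for nonseparable graphs and passes from the two sides of a cutvertex to the whole. It
  replaces any manipulation of the block-cut tree.
\<close>
lemma connected_separation_induct [consumes 3, case_names nonseparable separation]:
  assumes "fin_digraph G" "loopfree_digraph G" "Digraph_Component.connected G"
    and base: "\<And>G. fin_digraph G \<Longrightarrow> loopfree_digraph G \<Longrightarrow> nonseparable G \<Longrightarrow> P G"
    and step: "\<And>G c X Y. cut_separation G c X Y \<Longrightarrow> P (G \<restriction> insert c X) \<Longrightarrow> P (G \<restriction> insert c Y) \<Longrightarrow> P G"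
  shows "P G"
  using assms(1-3)
proof (induction "card (verts G)" arbitrary: G rule: less_induct)
  case less
  show ?case
  proof (cases "nonseparable G")
    case True
    with less.prems show ?thesis by (intro base)
  next
    case False
    with less.prems obtain c X Y where sep: "cut_separation G c X Y"
      using cutvertex_separation unfolding nonseparable_def by metis
    interpret cut_separation G c X Y by fact
    interpret S: cut_separation G c Y X by (rule swap)
    from less.hyps[OF side_smaller side_fin side_loopfree side_connected]
      less.hyps[OF S.side_smaller S.side_fin S.side_loopfree S.side_connected]
    show ?thesis by (rule step[OF sep])
  qed
qed

lemma finite_blocks:
  assumes "fin_digraph G" "loopfree_digraph G" "Digraph_Component.connected G"
  shows "finite (blocks G)"
  using assms
proof (induction rule: connected_separation_induct)
  case (nonseparable G)
  then show ?case by (simp add: blocks_nonseparable fin_digraph_def)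
next
  case (separation G c X Y)
  then show ?case by (simp add: cut_separation.blocks_split)
qed

lemma distinct_blocks_share_at_most_one:
  assumes "fin_digraph G" "loopfree_digraph G" "Digraph_Component.connected G"
    and "B \<in> blocks G" "B' \<in> blocks G" "B \<noteq> B'" "u \<in> verts B \<inter> verts B'" "v \<in> verts B \<inter> verts B'"
  shows "u = v"
  using assms
proof (induction rule: connected_separation_induct)
  case (nonseparable G)
  then show ?case by (simp add: blocks_nonseparable fin_digraph_def)
next
  case (separation G c X Y)
  interpret cut_separation G c X Y by fact
  have "verts C \<subseteq> insert c X" if "C \<in> blocks side1" for C
    using block_subgraph[OF that] by (auto simp: subgraph_def)
  moreover have "verts C \<subseteq> insert c Y" if "C \<in> blocks side2" for C
    using block_subgraph[OF that] by (auto simp: subgraph_def)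
  ultimately show ?case using separation parts unfolding blocks_split by blast
qed


section \<open>Configurations of nodes on a lattice\<close>

text \<open>
  Fubini for products of two absolutely convergent families. It is used with the norms of kernels
  for summability, and with the complex weights for the factorization itself.
\<close>
lemma product_abs_summable:
  fixes f :: "'a \<Rightarrow> 'c::{real_normed_div_algebra, banach}" and g :: "'b \<Rightarrow> 'c"
  assumes "(\<lambda>x. norm (f x)) summable_on A" "(\<lambda>y. norm (g y)) summable_on B"
  shows "(\<lambda>z. norm (f (fst z) * g (snd z))) summable_on A \<times> B"
proof (rule Infinite_Sum.abs_summable_on_Sigma_iff[THEN iffD2], intro conjI ballI)
  show "(\<lambda>y. norm (f (fst (x, y)) * g (snd (x, y)))) summable_on B" for x
    using assms(2) by (simp add: norm_mult summable_on_cmult_right)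
  have "infsum (\<lambda>y. norm (f (fst (x, y)) * g (snd (x, y)))) B
      = norm (f x) * infsum (\<lambda>y. norm (g y)) B" for x
    using assms(2) by (simp add: norm_mult infsum_cmult_right)
  moreover have "infsum (\<lambda>y. norm (g y)) B \<ge> 0" by (rule infsum_nonneg) simp
  ultimately show "(\<lambda>x. norm (infsum (\<lambda>y. norm (f (fst (x, y)) * g (snd (x, y)))) B)) summable_on A"
    using assms(1) by (simp add: abs_mult summable_on_cmult_left)
qed

lemma infsum_product:
  fixes f :: "'a \<Rightarrow> 'c::{real_normed_div_algebra, banach}" and g :: "'b \<Rightarrow> 'c"
  assumes "(\<lambda>x. norm (f x)) summable_on A" "(\<lambda>y. norm (g y)) summable_on B"
  shows "infsum (\<lambda>z. f (fst z) * g (snd z)) (A \<times> B) = infsum f A * infsum g B"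
proof -
  have "(\<lambda>z. f (fst z) * g (snd z)) summable_on A \<times> B"
    by (rule abs_summable_summable[OF product_abs_summable[OF assms]])
  from infsum_Sigma_banach[OF this]
  have "infsum (\<lambda>z. f (fst z) * g (snd z)) (A \<times> B) = infsum (\<lambda>x. infsum (\<lambda>y. f x * g y) B) A"
    by simp
  also have "\<dots> = infsum (\<lambda>x. f x * infsum g B) A"
    by (intro infsum_cong infsum_cmult_right abs_summable_summable[OF assms(2)])
  also have "\<dots> = infsum f A * infsum g B"
    by (intro infsum_cmult_left abs_summable_summable[OF assms(1)])
  finally show ?thesis .
qed

text \<open>
  Placements of all nodes of \<open>V\<close> in \<open>L\<close> with \<open>p\<close> at \<open>a\<close>. Keeping \<open>p\<close> in the domain, instead of summing over
  the remaining nodes, makes changing the pinned node a plain translation.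
\<close>
definition configs :: "'a set \<Rightarrow> 'v set \<Rightarrow> 'v \<Rightarrow> 'a \<Rightarrow> ('v \<Rightarrow> 'a) set" where
  "configs L V p a = {x \<in> V \<rightarrow>\<^sub>E L. x p = a}"

lemma configs_iff:
  "x \<in> configs L V p a \<longleftrightarrow> (\<forall>v \<in> V. x v \<in> L) \<and> (\<forall>v. v \<notin> V \<longrightarrow> x v = undefined) \<and> x p = a"
  by (auto simp: configs_def PiE_iff extensional_def)

text \<open>
  Once the shared node \<open>c\<close> is pinned, the positions of the remaining nodes of \<open>V1\<close> and of \<open>V2\<close> vary
  independently, so the sum over placements of \<open>V1 \<union> V2\<close> is a sum over a product set.
\<close>
lemma infsum_configs_glue:
  fixes f g :: "('v \<Rightarrow> 'a) \<Rightarrow> 'c::{real_normed_div_algebra, banach}"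
  assumes meet: "V1 \<inter> V2 = {c}" 
    and "(\<lambda>x. norm (f x)) summable_on configs L V1 c a" "(\<lambda>x. norm (g x)) summable_on configs L V2 c a"
    and f: "\<And>x. f (restrict x V1) = f x" and g: "\<And>x. g (restrict x V2) = g x"
  shows "infsum (\<lambda>x. f x * g x) (configs L (V1 \<union> V2) c a)
    = infsum f (configs L V1 c a) * infsum g (configs L V2 c a)"
proof -
  let ?j = "\<lambda>x. (restrict x V1, restrict x V2)"
  let ?i = "\<lambda>z v. if v \<in> V1 then fst z v else snd z v"
  have "infsum (\<lambda>x. f x * g x) (configs L (V1 \<union> V2) c a)
      = infsum (\<lambda>z. f (fst z) * g (snd z)) (configs L V1 c a \<times> configs L V2 c a)"
  proof (rule infsum_reindex_bij_witness[where i = ?i and j = ?j])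
    fix x assume x: "x \<in> configs L (V1 \<union> V2) c a"
    then show "?i (?j x) = x" by (auto simp: configs_def fun_eq_iff PiE_def extensional_def)
    show "?j x \<in> configs L V1 c a \<times> configs L V2 c a"
      using x meet by (auto simp: configs_def PiE_def)
    show "f (fst (?j x)) * g (snd (?j x)) = f x * g x" by (simp add: f g)
  next
    fix z assume z: "z \<in> configs L V1 c a \<times> configs L V2 c a"
    have "snd z v = fst z v" if "v \<in> V1" "v \<in> V2" for v
    proof -
      from that meet have "v = c" by auto
      with z show ?thesis by (auto simp: configs_def)
    qed
    with z show "?j (?i z) = z"
      by (auto simp: configs_def fun_eq_iff PiE_def extensional_def prod_eq_iff)
    show "?i z \<in> configs L (V1 \<union> V2) c a"
      using z meet by (auto simp: configs_def PiE_def extensional_def)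
  qed
  also have "\<dots> = infsum f (configs L V1 c a) * infsum g (configs L V2 c a)"
    by (rule infsum_product) fact+
  finally show ?thesis .
qed

definition kernel_product ::
    "('e \<Rightarrow> 'a::minus \<Rightarrow> complex) \<Rightarrow> ('v, 'e) pre_digraph \<Rightarrow> ('v \<Rightarrow> 'a) \<Rightarrow> complex" where
  "kernel_product K G x = (\<Prod>e\<in>arcs G. K e (x (head G e) - x (tail G e)))"

text \<open>
  The Fourier factor of a graph lattice sum. Its multiplicativity along chains of nodes is what
  distributes the momentum over the spine.
\<close>
definition phase :: "'v \<Rightarrow> 'v \<Rightarrow> 'a::real_inner \<Rightarrow> ('v \<Rightarrow> 'a) \<Rightarrow> complex" where
  "phase s t k x = exp (- 2 * complex_of_real pi * \<i> * complex_of_real ((x t - x s) \<bullet> k))"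

lemma norm_phase [simp]: "norm (phase s t k x) = 1"
  by (simp add: phase_def)

lemma phase_same [simp]: "phase s s k x = 1" and phase_zero [simp]: "phase s t 0 x = 1"
  by (simp_all add: phase_def)

lemma phase_trans: "phase s u k x * phase u t k x = phase s t k x"
  by (simp add: phase_def exp_add[symmetric] algebra_simps inner_diff_left)

lemma graph_lattice_sum_configs:
  assumes "wf_digraph G" "s \<in> verts G" "t \<in> verts G" "p \<in> verts G" "a \<in> L"
  shows "graph_lattice_sum L K G s t p a k
    = infsum (\<lambda>x. phase s t k x * kernel_product K G x) (configs L (verts G) p a)"
  unfolding graph_lattice_sum_def Let_def kernel_product_def[symmetric] phase_def[symmetric]
proof (rule infsum_reindex_bij_witness
    [where i = "\<lambda>x. x(p := undefined)" and j = "\<lambda>y. y(p := a)"])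
  fix y assume "y \<in> (\<Pi>\<^sub>E v \<in> verts G - {p}. L)"
  then show "(y(p := a))(p := undefined) = y" "y(p := a) \<in> configs L (verts G) p a"
    using assms by (auto simp: configs_def PiE_def extensional_def fun_eq_iff)
next
  fix x assume "x \<in> configs L (verts G) p a"
  then show "(x(p := undefined))(p := a) = x" "x(p := undefined) \<in> (\<Pi>\<^sub>E v \<in> verts G - {p}. L)"
    using assms by (auto simp: configs_def PiE_def extensional_def fun_eq_iff)
qed simp

locale additive_subgroup =
  fixes L :: "'a::real_inner set"
  assumes zero_mem: "0 \<in> L" and diff_mem: "a \<in> L \<Longrightarrow> b \<in> L \<Longrightarrow> a - b \<in> L"
begin

lemma add_mem: "a \<in> L \<Longrightarrow> b \<in> L \<Longrightarrow> a + b \<in> L"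
  using diff_mem[of a "- b"] diff_mem[OF zero_mem, of b] by simp

text \<open>
  Translating a placement so that \<open>q\<close> lands on \<open>b\<close> is a bijection between the placements pinned at \<open>p\<close>
  and those pinned at \<open>q\<close>; a translation-invariant summand does not notice it.
\<close>
lemma infsum_configs_repin:
  assumes "p \<in> V" "q \<in> V" "a \<in> L" "b \<in> L"
    and inv: "\<And>x d. f (\<lambda>v\<in>V. x v + d) = f x"
  shows "infsum f (configs L V p a) = infsum f (configs L V q b)"
proof (rule infsum_reindex_bij_witness
    [where i = "\<lambda>x. \<lambda>v\<in>V. x v + (a - x p)" and j = "\<lambda>x. \<lambda>v\<in>V. x v + (b - x q)"])
  show "f (\<lambda>v\<in>V. x v + (b - x q)) = f x" for x by (rule inv)
qed (use assms(1-4) in \<open>auto simp: configs_def PiE_iff extensional_def fun_eq_iff intro!: add_mem diff_mem\<close>)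

text \<open>
  The proof grows a spanning tree from \<open>p\<close>. When a node \<open>v\<close> is added along an arc \<open>e\<close>, the difference of
  the end points of \<open>e\<close> serves as the coordinate of \<open>v\<close>, so that the kernel of \<open>e\<close> becomes an independent
  summable factor. All other arcs that the new node closes are bounded by constants, since a
  summable kernel is bounded by its norm sum.
\<close>
lemma kernel_product_abs_summable:
  fixes K :: "'e \<Rightarrow> 'a \<Rightarrow> complex"
  assumes "fin_digraph G" "Digraph_Component.connected G"
    and K: "\<And>e. e \<in> arcs G \<Longrightarrow> (\<lambda>x. norm (K e x)) summable_on L"
    and "p \<in> verts G" "a \<in> L"
  shows "(\<lambda>x. norm (kernel_product K G x)) summable_on configs L (verts G) p a"
proof -
  interpret fin_digraph G by fact
  define A where "A W = {e \<in> arcs G. tail G e \<in> W \<and> head G e \<in> W}" for W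
  define w where "w F x = (\<Prod>e\<in>F. norm (K e (x (head G e) - x (tail G e))))" for F x
  \<comment> \<open>\<open>good W\<close>: the claim for the subgraph induced by \<open>W\<close>; a largest good set is everything\<close>
  define good where "good W \<longleftrightarrow> p \<in> W \<and> W \<subseteq> verts G \<and> w (A W) summable_on configs L W p a" for W
  have fin_A: "finite (A W)" for W by (simp add: A_def)
  have bound: "norm (K e x) \<le> infsum (\<lambda>x. norm (K e x)) L" if "e \<in> arcs G" "x \<in> L" for e x
    using finite_sum_le_infsum[OF K[OF that(1)], of "{x}"] that by simp
  have "good {p}"
  proof -
    have "configs L {p} p a \<subseteq> {\<lambda>v\<in>{p}. a}"
      by (auto simp: configs_def PiE_def extensional_def fun_eq_iff)
    then have "finite (configs L {p} p a)" by (rule finite_subset) simp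
    then show ?thesis using assms(4) by (simp add: good_def summable_on_finite)
  qed
  have grow: "\<exists>v. v \<notin> W \<and> good (insert v W)" if W: "good W" "W \<noteq> verts G" for W
  proof -
    from W have pW: "p \<in> W" and sub: "W \<subseteq> verts G" and sumW: "w (A W) summable_on configs L W p a"
      by (auto simp: good_def)
    obtain e where e: "e \<in> arcs G" "(tail G e \<in> W) \<noteq> (head G e \<in> W)"
      using connected_crossing_arcE[OF wf_digraph assms(2) sub] pW W(2) by blast
    define v where "v = (if tail G e \<in> W then head G e else tail G e)"
    define u where "u = (if tail G e \<in> W then tail G e else head G e)"
    have v: "v \<notin> W" "v \<in> verts G" and u: "u \<in> W"
      using e by (auto simp: v_def u_def)
    \<comment> \<open>\<open>pos x z\<close> is the position of \<open>v\<close> for which the arc \<open>e\<close> has difference vector \<open>z\<close>\<close>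
    define pos where "pos x z = (if tail G e \<in> W then x u + z else x u - z)" for x and z :: 'a
    define coord where "coord y = y (head G e) - y (tail G e)" for y :: "_ \<Rightarrow> 'a"
    let ?ext = "\<lambda>z. (fst z)(v := pos (fst z) (snd z))"
    let ?N = "A (insert v W) - A W"
    let ?bound = "\<Prod>e' \<in> ?N - {e}. infsum (\<lambda>x. norm (K e' x)) L"
    have uv: "u \<noteq> v" using u v by auto
    have local: "w (A W) x = w (A W) y" if "\<And>v. v \<in> W \<Longrightarrow> x v = y v" for x y
      unfolding w_def using that by (intro prod.cong) (auto simp: A_def)
    have "(\<lambda>z. norm (w (A W) (fst z) * norm (K e (snd z)))) summable_on configs L W p a \<times> L"
      using sumW K[OF e(1)] unfolding w_def
      by (intro product_abs_summable) (simp_all add: abs_prod)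
    then have "(\<lambda>z. w (A W) (fst z) * norm (K e (snd z))) summable_on configs L W p a \<times> L"
      by (simp add: w_def abs_mult abs_prod)
    also have "?this \<longleftrightarrow> (\<lambda>y. w (A W) y * norm (K e (coord y))) summable_on configs L (insert v W) p a"
    proof (rule summable_on_reindex_bij_witness[where i = "\<lambda>y. (restrict y W, coord y)" and j = ?ext])
      fix z assume "z \<in> configs L W p a \<times> L"
      then obtain x d where z: "z = (x, d)" and x: "x \<in> configs L W p a" and d: "d \<in> L" by blast
      have coord: "coord (?ext z) = d"
        using e(2) uv unfolding z coord_def pos_def u_def v_def by (cases "tail G e \<in> W") auto
      have "restrict (?ext z) W = x"
        using x v(1) unfolding z configs_iff by (auto simp: fun_eq_iff)
      with coord show "(restrict (?ext z) W, coord (?ext z)) = z" by (simp add: z)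
      have "pos x d \<in> L"
        using x u d by (simp add: pos_def add_mem diff_mem configs_iff)
      then show "?ext z \<in> configs L (insert v W) p a"
        using x v(1) pW unfolding z configs_iff by auto
      have "w (A W) (?ext z) = w (A W) x" using v(1) by (intro local) (auto simp: z)
      with coord show "w (A W) (?ext z) * norm (K e (coord (?ext z))) = w (A W) (fst z) * norm (K e (snd z))"
        by (simp add: z)
    next
      fix y assume y: "y \<in> configs L (insert v W) p a"
      have "pos (restrict y W) (coord y) = y v"
        using u e(2) unfolding pos_def coord_def u_def v_def by (cases "tail G e \<in> W") auto
      then show "?ext (restrict y W, coord y) = y"
        using y v(1) unfolding configs_iff by (auto simp: fun_eq_iff)
      have "y (head G e) \<in> L" "y (tail G e) \<in> L"
        using y e(2) unfolding configs_iff v_def by (auto split: if_splits)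
      then have "coord y \<in> L" unfolding coord_def by (rule diff_mem)
      then show "(restrict y W, coord y) \<in> configs L W p a \<times> L"
        using y pW by (auto simp: configs_iff)
    qed
    finally have "(\<lambda>y. w (A W) y * norm (K e (coord y)) * ?bound) summable_on configs L (insert v W) p a"
      by (rule summable_on_cmult_left)
    then have "(\<lambda>y. norm (w (A (insert v W)) y)) summable_on configs L (insert v W) p a"
    proof (rule Infinite_Sum.abs_summable_on_comparison_test')
      fix y assume y: "y \<in> configs L (insert v W) p a"
      have "head G e \<in> insert v W" "tail G e \<in> insert v W" using e(2) by (simp_all add: v_def)
      with e have eN: "e \<in> ?N" by (auto simp: A_def)
      have "w (A (insert v W)) y = w ?N y * w (A W) y"
        unfolding w_def by (rule prod.subset_diff[OF _ fin_A]) (auto simp: A_def)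
      moreover have "w ?N y = norm (K e (coord y)) * w (?N - {e}) y"
        unfolding w_def coord_def by (rule prod.remove[OF finite_Diff[OF fin_A] eN])
      ultimately have "w (A (insert v W)) y = w (A W) y * (norm (K e (coord y)) * w (?N - {e}) y)"
        by simp
      moreover have "w (?N - {e}) y \<le> ?bound"
        unfolding w_def
      proof (intro prod_mono conjI bound)
        fix e' assume "e' \<in> ?N - {e}"
        then have e': "e' \<in> arcs G" "head G e' \<in> insert v W" "tail G e' \<in> insert v W"
          by (simp_all add: A_def)
        show "e' \<in> arcs G" by (rule e'(1))
        have "\<forall>u \<in> insert v W. y u \<in> L" using y unfolding configs_iff by blast
        with e' show "y (head G e') - y (tail G e') \<in> L" by (intro diff_mem) blast+
      qed simp
      moreover have "0 \<le> w F y" for F by (simp add: w_def prod_nonneg)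
      ultimately show "norm (w (A (insert v W)) y) \<le> w (A W) y * norm (K e (coord y)) * ?bound"
        by (simp add: mult.assoc) (intro mult_left_mono, simp_all)
    qed
    moreover have "norm (w F y) = w F y" for F y by (simp add: w_def abs_prod)
    ultimately have "good (insert v W)" using pW sub v by (simp add: good_def)
    with v show ?thesis by blast
  qed
  have "\<forall>W. good W \<longrightarrow> card W < Suc (card (verts G))"
    using card_mono[OF finite_verts] by (auto simp: good_def less_Suc_eq_le)
  from ex_has_greatest_nat[OF \<open>good {p}\<close> this]
  obtain W where W: "good W" and max: "\<And>W'. good W' \<Longrightarrow> card W' \<le> card W" by blast
  have "W = verts G"
  proof (rule ccontr)
    assume "W \<noteq> verts G"
    with grow W obtain v where "v \<notin> W" "good (insert v W)" by blast
    moreover have "finite W" using W finite_subset[OF _ finite_verts] by (auto simp: good_def)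
    ultimately show False using max[of "insert v W"] by simp
  qed
  moreover have "A (verts G) = arcs G" by (auto simp: A_def)
  ultimately show ?thesis using W by (simp add: good_def w_def[abs_def] kernel_product_def flip: prod_norm)
qed

end


section \<open>Factorization over the blocks\<close>

text \<open>
  The summand of a graph lattice sum in which every block \<open>B\<close> carries its own terminals and its own
  momentum \<open>\<kappa> B\<close>. This generality makes the factorization provable by induction over cutvertices,
  where no global spine is visible; attachments are the case \<open>\<kappa> B = 0\<close>.
\<close>
definition block_weight ::
    "('e \<Rightarrow> 'a::real_inner \<Rightarrow> complex) \<Rightarrow> (('v, 'e) pre_digraph \<Rightarrow> 'v) \<Rightarrow> (('v, 'e) pre_digraph \<Rightarrow> 'v)
      \<Rightarrow> (('v, 'e) pre_digraph \<Rightarrow> 'a) \<Rightarrow> ('v, 'e) pre_digraph \<Rightarrow> ('v \<Rightarrow> 'a) \<Rightarrow> complex" where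
  "block_weight K \<sigma> \<tau> \<kappa> G x =
    (\<Prod>B\<in>blocks G. phase (\<sigma> B) (\<tau> B) (\<kappa> B) x) * kernel_product K G x"

lemma norm_block_weight: "norm (block_weight K \<sigma> \<tau> \<kappa> G x) = norm (kernel_product K G x)"
  by (simp add: block_weight_def norm_mult flip: prod_norm)

text \<open>
  Only differences of positions within \<open>G\<close> enter. This gives both translation invariance, for moving
  the pinned node, and independence of the nodes outside \<open>G\<close>, for gluing.
\<close>
lemma block_weight_cong:
  assumes "wf_digraph G"
    and "\<And>B. B \<in> blocks G \<Longrightarrow> \<sigma> B \<in> verts B \<and> \<tau> B \<in> verts B"
    and diff: "\<And>u v. u \<in> verts G \<Longrightarrow> v \<in> verts G \<Longrightarrow> x u - x v = y u - y v"
  shows "block_weight K \<sigma> \<tau> \<kappa> G x = block_weight K \<sigma> \<tau> \<kappa> G y"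
proof -
  have "phase (\<sigma> B) (\<tau> B) (\<kappa> B) x = phase (\<sigma> B) (\<tau> B) (\<kappa> B) y" if "B \<in> blocks G" for B
  proof -
    have "verts B \<subseteq> verts G" using block_subgraph[OF that] by (simp add: subgraph_def)
    then have "x (\<tau> B) - x (\<sigma> B) = y (\<tau> B) - y (\<sigma> B)" using assms(2)[OF that] by (intro diff) auto
    then show ?thesis by (simp add: phase_def)
  qed
  moreover have "kernel_product K G x = kernel_product K G y"
    unfolding kernel_product_def using wf_digraph.wellformed[OF assms(1)]
    by (intro prod.cong refl arg_cong[where f = "K _"] diff)
  ultimately show ?thesis by (simp add: block_weight_def)
qed

lemma (in cut_separation) block_weight_split:
  "block_weight K \<sigma> \<tau> \<kappa> G x = block_weight K \<sigma> \<tau> \<kappa> side1 x * block_weight K \<sigma> \<tau> \<kappa> side2 x"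
proof -
  interpret S: cut_separation G c Y X by (rule swap)
  have "finite (blocks side1)" "finite (blocks side2)"
    using finite_blocks side_fin side_loopfree side_connected
      S.side_fin S.side_loopfree S.side_connected by blast+
  then have "(\<Prod>B\<in>blocks G. phase (\<sigma> B) (\<tau> B) (\<kappa> B) x)
      = (\<Prod>B\<in>blocks side1. phase (\<sigma> B) (\<tau> B) (\<kappa> B) x) * (\<Prod>B\<in>blocks side2. phase (\<sigma> B) (\<tau> B) (\<kappa> B) x)"
    unfolding blocks_split by (rule prod.union_disjoint) (rule blocks_disjoint)
  moreover have "kernel_product K G x = kernel_product K side1 x * kernel_product K side2 x"
  proof -
    have fin: "finite (arcs side1)" "finite (arcs side2)"
      using side_fin S.side_fin by (simp_all only: fin_digraph.finite_arcs)
    show ?thesis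
      unfolding kernel_product_def arcs_split induce_subgraph_head induce_subgraph_tail
      by (rule prod.union_disjoint[OF fin arcs_disjoint])
  qed
  ultimately show ?thesis by (simp add: block_weight_def)
qed

text \<open>
  The factorization in its natural form. In the induction step the whole sum is pinned at the
  cutvertex, where it becomes the product of the sums of the two sides.
\<close>
theorem infsum_block_weight:
  fixes L :: "(real^'n) set" and G :: "(nat, 'e) pre_digraph"
  assumes "additive_subgroup L"
    and "fin_digraph G" "loopfree_digraph G" "Digraph_Component.connected G"
    and "\<And>e. e \<in> arcs G \<Longrightarrow> (\<lambda>x. norm (K e x)) summable_on L"
    and "p \<in> verts G" "a \<in> L"
    and "\<And>B. B \<in> blocks G \<Longrightarrow> \<sigma> B \<in> verts B \<and> \<tau> B \<in> verts B"
    and "\<And>B. B \<in> blocks G \<Longrightarrow> pin B \<in> verts B \<and> pos B \<in> L"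
  shows "infsum (block_weight K \<sigma> \<tau> \<kappa> G) (configs L (verts G) p a)
    = (\<Prod>B\<in>blocks G. graph_lattice_sum L K B (\<sigma> B) (\<tau> B) (pin B) (pos B) (\<kappa> B))"
  using assms(2-)
proof (induction arbitrary: p a rule: connected_separation_induct)
  case (nonseparable G)
  interpret additive_subgroup L by fact
  interpret fin_digraph G by fact
  have G: "blocks G = {G}" using nonseparable.hyps by (simp add: blocks_nonseparable wf_digraph)
  have "infsum (block_weight K \<sigma> \<tau> \<kappa> G) (configs L (verts G) p a)
      = infsum (block_weight K \<sigma> \<tau> \<kappa> G) (configs L (verts G) (pin G) (pos G))"
    using nonseparable.prems G
    by (intro infsum_configs_repin block_weight_cong wf_digraph) auto
  also have "\<dots> = graph_lattice_sum L K G (\<sigma> G) (\<tau> G) (pin G) (pos G) (\<kappa> G)"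
    using nonseparable.prems G
    by (subst graph_lattice_sum_configs[OF wf_digraph]) (auto simp: block_weight_def[abs_def])
  finally show ?case by (simp add: G)
next
  case (separation G c X Y)
  interpret additive_subgroup L by fact
  interpret cut_separation G c X Y by fact
  interpret S: cut_separation G c Y X by (rule swap)
  have terminals: "\<sigma> B \<in> verts B \<and> \<tau> B \<in> verts B" "pin B \<in> verts B \<and> pos B \<in> L"
    if "B \<in> blocks side1 \<or> B \<in> blocks side2" for B
    using separation.prems that blocks_split by auto
  have K: "(\<lambda>x. norm (K e x)) summable_on L" if "e \<in> arcs side1 \<or> e \<in> arcs side2" for e
    using separation.prems(1) that arcs_split by blast
  have wf: "wf_digraph side1" "wf_digraph side2"
    using side_subgraph S.side_subgraph by auto
  have verts: "verts G = verts side1 \<union> verts side2" "verts side1 \<inter> verts side2 = {c}"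
    using verts_split parts by auto
  let ?w = "block_weight K \<sigma> \<tau> \<kappa>"
  have "infsum (?w G) (configs L (verts G) p a) = infsum (?w G) (configs L (verts G) c a)"
    using separation.prems verts
    by (intro infsum_configs_repin block_weight_cong wf_digraph) auto
  also have "\<dots> = infsum (\<lambda>x. ?w side1 x * ?w side2 x) (configs L (verts side1 \<union> verts side2) c a)"
    unfolding verts(1) by (intro infsum_cong block_weight_split)
  also have "\<dots> = infsum (?w side1) (configs L (verts side1) c a)
      * infsum (?w side2) (configs L (verts side2) c a)"
  proof (rule infsum_configs_glue[OF verts(2)])
    show "(\<lambda>x. norm (?w side1 x)) summable_on configs L (verts side1) c a"
      unfolding norm_block_weight using K separation.prems(3)
      by (intro kernel_product_abs_summable side_fin side_connected) auto
    show "(\<lambda>x. norm (?w side2 x)) summable_on configs L (verts side2) c a"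
      unfolding norm_block_weight using K separation.prems(3)
      by (intro kernel_product_abs_summable S.side_fin S.side_connected) auto
    show "?w side1 (restrict x (verts side1)) = ?w side1 x" for x
      using terminals by (intro block_weight_cong wf) auto
    show "?w side2 (restrict x (verts side2)) = ?w side2 x" for x
      using terminals by (intro block_weight_cong wf) auto
  qed
  also have "infsum (?w side1) (configs L (verts side1) c a)
      = (\<Prod>B\<in>blocks side1. graph_lattice_sum L K B (\<sigma> B) (\<tau> B) (pin B) (pos B) (\<kappa> B))"
    using K terminals separation.prems(3) by (intro separation.IH(1)) auto
  also have "infsum (?w side2) (configs L (verts side2) c a)
      = (\<Prod>B\<in>blocks side2. graph_lattice_sum L K B (\<sigma> B) (\<tau> B) (pin B) (pos B) (\<kappa> B))"
    using K terminals separation.prems(3) by (intro separation.IH(2)) auto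
  finally show ?case
    unfolding blocks_split
    by (simp only: prod.union_disjoint[OF finite_blocks[OF side_fin side_loopfree side_connected]
      finite_blocks[OF S.side_fin S.side_loopfree S.side_connected] blocks_disjoint])
qed


section \<open>The spine\<close>

lemma phase_telescope:
  fixes m :: nat
  shows "(\<Prod>i = 1..m. phase (f (i - 1)) (f i) k x) = phase (f 0) (f m) k x"
  by (induction m) (simp_all add: phase_trans)

text \<open>
  Walks in the block-cut tree alternate between blocks and cutvertices, so the blocks on a walk
  form a chain in which consecutive blocks meet.
\<close>
lemma block_cut_tree_walk:
  assumes "vwalk q (block_cut_tree G)" "hd q = Inl B" "last q = Inl B'"
  defines "Bs \<equiv> map projl (filter isl q)"
  shows "Bs \<noteq> [] \<and> hd Bs = B \<and> last Bs = B' \<and> successively (\<lambda>C D. verts C \<inter> verts D \<noteq> {}) Bs"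
  using assms(1-3) unfolding Bs_def
proof (induction "length q" arbitrary: q B rule: less_induct)
  case less
  have arcs: "(x, y) \<in> arcs_ends (block_cut_tree G) \<longleftrightarrow>
      (\<exists>C c. c \<in> verts C \<and> C \<in> blocks G \<and> cutvertex G c \<and> (x = Inl C \<and> y = Inr c \<or> x = Inr c \<and> y = Inl C))"
    for x y
    by (auto simp: block_cut_tree_def arcs_ends_def arc_to_ends_def image_iff)
  show ?case
  proof (cases q)
    case Nil
    with less.prems show ?thesis by (simp add: vwalk_def)
  next
    case q1: (Cons x q')
    show ?thesis
    proof (cases q')
      case Nil
      with q1 less.prems show ?thesis by simp
    next
      case q2: (Cons y q'')
      from less.prems q1 q2 have "(Inl B, y) \<in> arcs_ends (block_cut_tree G)" "x = Inl B"
        by (auto simp: vwalk_def)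
      then obtain c where y: "y = Inr c" "c \<in> verts B" unfolding arcs by auto
      show ?thesis
      proof (cases q'')
        case Nil
        with q1 q2 y less.prems show ?thesis by simp
      next
        case q3: (Cons z r)
        from less.prems q1 q2 q3 have "(Inr c, z) \<in> arcs_ends (block_cut_tree G)"
          by (auto simp: vwalk_def y)
        then obtain C where C: "z = Inl C" "c \<in> verts C" unfolding arcs by auto
        have "vwalk q'' (block_cut_tree G)"
          using less.prems(1) q1 q2 q3 by (simp add: vwalk_def)
        then have "map projl (filter isl q'') \<noteq> [] \<and> hd (map projl (filter isl q'')) = C \<and>
            last (map projl (filter isl q'')) = B' \<and>
            successively (\<lambda>C D. verts C \<inter> verts D \<noteq> {}) (map projl (filter isl q''))"
          using less.prems(3) q1 q2 q3 C by (intro less.hyps) auto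
        then show ?thesis
          using q1 q2 y \<open>x = Inl B\<close> C by (auto simp: successively_Cons)
      qed
    qed
  qed
qed

text \<open>
  Two distinct blocks meet in at most one node, so consecutive spine blocks meet in exactly one;
  this is what makes \<^const>\<open>the_elem\<close> in the definition of the spine nodes return a genuine common node.
\<close>
lemma spine_structure:
  assumes "fin_digraph G" "loopfree_digraph G" "Digraph_Component.connected G"
    and "is_spine G s t Bs"
  shows "Bs \<noteq> []" "distinct Bs" "set Bs \<subseteq> blocks G"
    and "i < length Bs \<Longrightarrow> spine_node s t Bs i \<in> verts (Bs ! i) \<and> spine_node s t Bs (Suc i) \<in> verts (Bs ! i)"
proof -
  obtain q B B' where q: "vpath q (block_cut_tree G)" "hd q = Inl B" "s \<in> verts B"
    "last q = Inl B'" "t \<in> verts B'" and Bs: "Bs = map projl (filter isl q)"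
    using assms(4) unfolding is_spine_def by blast
  have walk: "vwalk q (block_cut_tree G)" "distinct q" using q(1) by (auto simp: vpath_def)
  note W = block_cut_tree_walk[OF walk(1) q(2,4), folded Bs]
  show "Bs \<noteq> []" using W by simp
  show dist: "distinct Bs"
    unfolding Bs distinct_map using walk(2) by (auto simp: inj_on_def isl_def)
  have "set q \<subseteq> verts (block_cut_tree G)" using walk(1) by (simp add: vwalk_def)
  then show sub: "set Bs \<subseteq> blocks G"
    by (auto simp: Bs block_cut_tree_def isl_def)
  have joint: "the_elem (verts (Bs ! j) \<inter> verts (Bs ! Suc j)) \<in> verts (Bs ! j) \<inter> verts (Bs ! Suc j)"
    if "Suc j < length Bs" for j
  proof -
    have "verts (Bs ! j) \<inter> verts (Bs ! Suc j) \<noteq> {}"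
      using W that by (auto simp: successively_conv_nth)
    then obtain c where c: "c \<in> verts (Bs ! j) \<inter> verts (Bs ! Suc j)" by blast
    have "Bs ! j \<in> set Bs" "Bs ! Suc j \<in> set Bs" using that by simp_all
    moreover have "Bs ! j \<noteq> Bs ! Suc j" using dist that by (simp add: nth_eq_iff_index_eq)
    ultimately have "v = c" if "v \<in> verts (Bs ! j) \<inter> verts (Bs ! Suc j)" for v
      using distinct_blocks_share_at_most_one[OF assms(1-3) _ _ _ that c] sub by blast
    with c have "verts (Bs ! j) \<inter> verts (Bs ! Suc j) = {c}" by blast
    then show ?thesis by simp
  qed
  have first: "s \<in> verts (Bs ! 0)" using W q(3) by (metis hd_conv_nth)
  have final: "t \<in> verts (Bs ! (length Bs - 1))" using W q(5) by (metis last_conv_nth)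
  assume i: "i < length Bs"
  show "spine_node s t Bs i \<in> verts (Bs ! i) \<and> spine_node s t Bs (Suc i) \<in> verts (Bs ! i)"
  proof
    show "spine_node s t Bs i \<in> verts (Bs ! i)"
      using first joint[of "i - 1"] i by (cases i) (auto simp: spine_node_def)
    show "spine_node s t Bs (Suc i) \<in> verts (Bs ! i)"
    proof (cases "Suc i = length Bs")
      case True
      with final have "t \<in> verts (Bs ! i)" by (metis diff_Suc_1)
      with True i show ?thesis by (auto simp: spine_node_def)
    next
      case False
      with joint[of i] i show ?thesis by (simp add: spine_node_def)
    qed
  qed
qed

text \<open>
  The phase of \<open>G\<close> telescopes over the spine nodes from \<open>s\<close> to \<open>t\<close>. So the summand of \<open>G\<close> is the block
  weight with momentum \<open>k\<close> on the spine blocks and \<open>0\<close> on the attachments.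
\<close>
theorem graph_lattice_sum_spine:
  fixes L :: "(real^'n) set" and G :: "(nat, 'e) pre_digraph"
  assumes L: "additive_subgroup L"
    and G: "fin_digraph G" "loopfree_digraph G" "Digraph_Component.connected G"
    and K: "\<And>e. e \<in> arcs G \<Longrightarrow> (\<lambda>x. norm (K e x)) summable_on L"
    and p: "s \<in> verts G" "t \<in> verts G" "p \<in> verts G" "a \<in> L"
    and ends: "\<And>B. B \<in> blocks G \<Longrightarrow> src B \<in> verts B \<and> snk B \<in> verts B"
    and pin: "\<And>B. B \<in> blocks G \<Longrightarrow> pin B \<in> verts B \<and> pos B \<in> L"
    and spine: "is_spine G s t Bs"
  shows "graph_lattice_sum L K G s t p a k =
    (\<Prod>i = 1..length Bs. graph_lattice_sum L K (Bs ! (i - 1))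
        (spine_node s t Bs (i - 1)) (spine_node s t Bs i) (pin (Bs ! (i - 1))) (pos (Bs ! (i - 1))) k)
    * (\<Prod>B \<in> blocks G - set Bs. graph_lattice_sum L K B (src B) (snk B) (pin B) (pos B) 0)"
proof -
  note S = spine_structure[OF G spine]
  \<comment> \<open>the spine blocks are distinct, so each has a well-defined position along the spine\<close>
  define idx where "idx B = (THE i. i < length Bs \<and> Bs ! i = B)" for B
  have idx: "idx (Bs ! i) = i" if "i < length Bs" for i
    unfolding idx_def using that S(2) by (auto simp: nth_eq_iff_index_eq)
  define \<sigma> where "\<sigma> B = (if B \<in> set Bs then spine_node s t Bs (idx B) else src B)" for B
  define \<tau> where "\<tau> B = (if B \<in> set Bs then spine_node s t Bs (Suc (idx B)) else snk B)" for B
  define \<kappa> where "\<kappa> B = (if B \<in> set Bs then k else 0)" for B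
  have on_spine: "\<sigma> (Bs ! (i - 1)) = spine_node s t Bs (i - 1)" "\<tau> (Bs ! (i - 1)) = spine_node s t Bs i"
    "\<kappa> (Bs ! (i - 1)) = k" if "i \<in> {1..length Bs}" for i
    using that idx[of "i - 1"] by (auto simp: \<sigma>_def \<tau>_def \<kappa>_def)
  have off_spine: "\<sigma> B = src B" "\<tau> B = snk B" "\<kappa> B = 0" if "B \<in> blocks G - set Bs" for B
    using that by (auto simp: \<sigma>_def \<tau>_def \<kappa>_def)
  have \<sigma>\<tau>: "\<sigma> B \<in> verts B \<and> \<tau> B \<in> verts B" if "B \<in> blocks G" for B
  proof (cases "B \<in> set Bs")
    case True
    then obtain i where "i < length Bs" "Bs ! i = B" by (auto simp: in_set_conv_nth)
    with S(4)[of i] idx[of i] True show ?thesis by (simp add: \<sigma>_def \<tau>_def)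
  next
    case False
    with ends[OF that] show ?thesis by (simp add: \<sigma>_def \<tau>_def)
  qed
  have bij: "bij_betw (\<lambda>i. Bs ! (i - 1)) {1..length Bs} (set Bs)"
  proof (rule bij_betw_imageI)
    show "inj_on (\<lambda>i. Bs ! (i - 1)) {1..length Bs}"
      using S(2) by (auto simp: inj_on_def nth_eq_iff_index_eq)
    have "(\<lambda>i. Bs ! (i - 1)) ` {1..length Bs} = (\<lambda>i. Bs ! i) ` {..<length Bs}"
      unfolding image_Suc_lessThan[symmetric] image_image by simp
    also have "\<dots> = set Bs" by (auto simp: set_conv_nth)
    finally show "(\<lambda>i. Bs ! (i - 1)) ` {1..length Bs} = set Bs" .
  qed
  have split: "(\<Prod>B\<in>blocks G. f B) = (\<Prod>i = 1..length Bs. f (Bs ! (i - 1))) * (\<Prod>B\<in>blocks G - set Bs. f B)"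
    for f :: "_ \<Rightarrow> complex"
    using prod.subset_diff[OF S(3) finite_blocks[OF G], of f]
      prod.reindex_bij_betw[OF bij, of f] by (simp add: mult.commute)
  have phases: "(\<Prod>B\<in>blocks G. phase (\<sigma> B) (\<tau> B) (\<kappa> B) x) = phase s t k x" for x
  proof -
    have "(\<Prod>B\<in>blocks G. phase (\<sigma> B) (\<tau> B) (\<kappa> B) x)
        = (\<Prod>i = 1..length Bs. phase (spine_node s t Bs (i - 1)) (spine_node s t Bs i) k x)"
      unfolding split using on_spine off_spine by simp
    also have "\<dots> = phase s t k x"
      unfolding phase_telescope using S(1) by (simp add: spine_node_def)
    finally show ?thesis .
  qed
  have "graph_lattice_sum L K G s t p a k
      = infsum (block_weight K \<sigma> \<tau> \<kappa> G) (configs L (verts G) p a)"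
    using G(1) p by (simp add: graph_lattice_sum_configs fin_digraph_def block_weight_def[abs_def] phases)
  also have "\<dots> = (\<Prod>B\<in>blocks G. graph_lattice_sum L K B (\<sigma> B) (\<tau> B) (pin B) (pos B) (\<kappa> B))"
    using infsum_block_weight[where \<sigma> = \<sigma> and \<tau> = \<tau> and \<kappa> = \<kappa>, OF L G K p(3,4) \<sigma>\<tau> pin] by simp
  finally show ?thesis unfolding split using on_spine off_spine by simp
qed

text \<open>
  For \<open>s = t\<close> the phase is \<open>1\<close>, which is also the product of the phases of all blocks at momentum \<open>0\<close>,
  whatever their terminals.
\<close>
lemma graph_lattice_sum_equal_terminals:
  fixes L :: "(real^'n) set" and G :: "(nat, 'e) pre_digraph"
  assumes "additive_subgroup L"
    and G: "fin_digraph G" "loopfree_digraph G" "Digraph_Component.connected G"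
    and "\<And>e. e \<in> arcs G \<Longrightarrow> (\<lambda>x. norm (K e x)) summable_on L"
    and p: "s \<in> verts G" "p \<in> verts G" "a \<in> L"
    and "\<And>B. B \<in> blocks G \<Longrightarrow> src B \<in> verts B \<and> snk B \<in> verts B"
    and "\<And>B. B \<in> blocks G \<Longrightarrow> pin B \<in> verts B \<and> pos B \<in> L"
  shows "graph_lattice_sum L K G s s p a k
    = (\<Prod>B\<in>blocks G. graph_lattice_sum L K B (src B) (snk B) (pin B) (pos B) 0)"
  using infsum_block_weight[where \<sigma> = src and \<tau> = snk and \<kappa> = "\<lambda>_. 0", OF assms(1-5) p(2,3) assms(9,10)]
    G(1) p by (simp add: graph_lattice_sum_configs fin_digraph_def block_weight_def[abs_def])

lemma lattice_additive_subgroup: "additive_subgroup (lattice A)"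
proof
  have "A *v 0 \<in> lattice A" unfolding lattice_def by (intro CollectI exI[of _ 0]) auto
  then show "0 \<in> lattice A" by simp
  fix a b assume "a \<in> lattice A" "b \<in> lattice A"
  then obtain y z where "a = A *v y" "b = A *v z" "\<forall>i. y $ i \<in> \<int>" "\<forall>i. z $ i \<in> \<int>"
    unfolding lattice_def by blast
  then show "a - b \<in> lattice A"
    unfolding lattice_def
    by (intro CollectI exI[of _ "y - z"]) (auto simp: matrix_vector_mult_diff_distrib)
qed

theorem theorem3p4:
  fixes A :: "real^'n^'n"
    and G :: "(nat, 'e) pre_digraph"
    and K :: "'e \<Rightarrow> real^'n \<Rightarrow> complex"
    and s t p :: nat
    and x\<^sub>0 k :: "real^'n"
    and pin src snk :: "(nat, 'e) pre_digraph \<Rightarrow> nat"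
    and pos :: "(nat, 'e) pre_digraph \<Rightarrow> real^'n"
  assumes "invertible A"
    and "fin_digraph G" and "loopfree_digraph G" and "Digraph_Component.connected G"
    and "s \<in> verts G" and "t \<in> verts G"
    and "\<And>e. e \<in> arcs G \<Longrightarrow> (\<lambda>x. norm (K e x)) summable_on lattice A"
    and "p \<in> verts G" and "x\<^sub>0 \<in> lattice A"
    and "\<And>B. B \<in> blocks G \<Longrightarrow> pin B \<in> verts B \<and> pos B \<in> lattice A"
    and "\<And>B. B \<in> blocks G \<Longrightarrow> src B \<in> verts B \<and> snk B \<in> verts B"
    and "k \<in> brillouin_zone A"
  shows "(\<forall>Bs. is_spine G s t Bs \<longrightarrow>
           graph_lattice_sum (lattice A) K G s t p x\<^sub>0 k =
             (\<Prod>i = 1..length Bs. graph_lattice_sum (lattice A) K (Bs ! (i - 1))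
                (spine_node s t Bs (i - 1)) (spine_node s t Bs i)
                (pin (Bs ! (i - 1))) (pos (Bs ! (i - 1))) k)
             * (\<Prod>B \<in> blocks G - set Bs.
                graph_lattice_sum (lattice A) K B (src B) (snk B) (pin B) (pos B) 0))
       \<and> (s = t \<longrightarrow>
           graph_lattice_sum (lattice A) K G s t p x\<^sub>0 k =
             (\<Prod>B \<in> blocks G. graph_lattice_sum (lattice A) K B (src B) (snk B) (pin B) (pos B) 0)
         \<and> (\<Prod>B \<in> blocks G. graph_lattice_sum (lattice A) K B (src B) (snk B) (pin B) (pos B) 0) =
             graph_lattice_sum (lattice A) K G s t p x\<^sub>0 0)"
proof -
  note G = assms(2-4) and K = assms(7) and pin = assms(10) and ends = assms(11)
  note L = lattice_additive_subgroup[of A]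
  show ?thesis
  proof (intro conjI allI impI)
    fix Bs assume "is_spine G s t Bs"
    with graph_lattice_sum_spine[where K = K, OF L G K assms(5,6,8,9) ends pin]
    show "graph_lattice_sum (lattice A) K G s t p x\<^sub>0 k =
        (\<Prod>i = 1..length Bs. graph_lattice_sum (lattice A) K (Bs ! (i - 1))
          (spine_node s t Bs (i - 1)) (spine_node s t Bs i)
          (pin (Bs ! (i - 1))) (pos (Bs ! (i - 1))) k)
        * (\<Prod>B \<in> blocks G - set Bs.
          graph_lattice_sum (lattice A) K B (src B) (snk B) (pin B) (pos B) 0)"
      by blast
  next
    assume "s = t"
    note equal = graph_lattice_sum_equal_terminals[where K = K, OF L G K assms(5,8,9) ends pin]
    from equal show "graph_lattice_sum (lattice A) K G s t p x\<^sub>0 k =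
        (\<Prod>B \<in> blocks G. graph_lattice_sum (lattice A) K B (src B) (snk B) (pin B) (pos B) 0)"
      unfolding \<open>s = t\<close>[symmetric] .
    from equal show "(\<Prod>B \<in> blocks G. graph_lattice_sum (lattice A) K B (src B) (snk B) (pin B) (pos B) 0) =
        graph_lattice_sum (lattice A) K G s t p x\<^sub>0 0"
      unfolding \<open>s = t\<close>[symmetric] by (rule sym)
  qed
qed

end
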